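(* Let $m\ge 0$ be an integer and let $A(g)$ and $B(g)$ be two quadrature rules on $[-1,1]$, both of degree $m$, such that $\mu_A := A(\phi_{m+1}) \neq \mu_B := B(\phi_{m+1})$. Let $\mu=\int_{-1}^1 t^{m+1}\,dt$ and consider the linear combination of rules $$Y(g)=\frac{\mu-\mu_B}{\mu_A-\mu_B}\,A(g)+\frac{\mu_A-\mu}{\mu_A-\mu_B}\,B(g).$$ Then the degree of the rule $Y(g)$ is at least $m+1$, i.e. $Y(\phi_j)=\int_{-1}^1 t^j\,dt$ for all $0\le j\le m+1$.
   Context: For a function $g$ on $[-1,1]$ put $I(g)=\int_{-1}^1 g(t)\,dt$. A quadrature rule $Q$ assigns to each (sufficiently smooth) function $g$ on $[-1,1]$ a real number $Q(g)$, an approximation of $I(g)$ computed from values of $g$ (and/or its derivatives) on a discrete set of points in $[-1,1]$. Monomials are denoted $\phi_j(t)=t^j$, $j=0,1,\ldots$. A rule $Q$ is of degree $m\ge 0$ if $Q(\phi_j)=I(\phi_j)$ for all $0\le j\le m$ but $Q(\phi_{m+1})\neq I(\phi_{m+1})$. *)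

theory Defs
  imports "HOL-Analysis.Analysis"
begin

definition I :: "(real \<Rightarrow> real) \<Rightarrow> real" where
  "I g = integral {-1..1} g"

definition \<phi> :: "nat \<Rightarrow> real \<Rightarrow> real" where
  "\<phi> j = (\<lambda>t. t ^ j)"

text \<open>
  \<open>C_derivs k g D\<close>: the function \<open>g\<close> is of class \<open>C\<^sup>k\<close> on \<open>[-1,1]\<close>, and \<open>D 0, ..., D k\<close> are
  its successive derivatives there. At the endpoints the derivatives are one-sided, so nothing
  is required of \<open>g\<close> outside \<open>[-1,1]\<close>.
\<close>

definition C_derivs :: "nat \<Rightarrow> (real \<Rightarrow> real) \<Rightarrow> (nat \<Rightarrow> real \<Rightarrow> real) \<Rightarrow> bool" where
  "C_derivs k g D \<longleftrightarrow>
     (\<forall>t\<in>{-1..1}. D 0 t = g t) \<and>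
     (\<forall>i<k. \<forall>t\<in>{-1..1}. (D i has_real_derivative D (Suc i) t) (at t within {-1..1})) \<and>
     continuous_on {-1..1} (D k)"

text \<open>
  A rule is computed from the values of \<open>g\<close> and/or its derivatives on a discrete set \<open>X\<close> of
  points of \<open>[-1,1]\<close>: for some \<open>k\<close>, its value at a \<open>C\<^sup>k\<close> function depends only on the derivatives
  of orders \<open>0, ..., k\<close> at the points of \<open>X\<close>. The case \<open>k = 0\<close> is that of rules using function
  values only. A rule is a total function in HOL; its values at functions that are not \<open>C\<^sup>k\<close> are
  unconstrained. Linearity is not part of the notion.
\<close>

definition quadrature_rule :: "((real \<Rightarrow> real) \<Rightarrow> real) \<Rightarrow> bool" where
  "quadrature_rule Q \<longleftrightarrow>
     (\<exists>X k. X \<subseteq> {-1..1} \<and> discrete X \<and>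
        (\<forall>g h D E. C_derivs k g D \<longrightarrow> C_derivs k h E \<longrightarrow>
           (\<forall>i\<le>k. \<forall>x\<in>X. D i x = E i x) \<longrightarrow> Q g = Q h))"

definition of_degree :: "((real \<Rightarrow> real) \<Rightarrow> real) \<Rightarrow> nat \<Rightarrow> bool" where
  "of_degree Q m \<longleftrightarrow> (\<forall>j\<le>m. Q (\<phi> j) = I (\<phi> j)) \<and> Q (\<phi> (m + 1)) \<noteq> I (\<phi> (m + 1))"

end

theory Submission
  imports Defs
begin

text \<open>The weights of \<open>A\<close> and \<open>B\<close> in \<open>Y\<close> sum to 1, so
  \<open>Y\<close> keeps every value on which the two rules agree; up to degree \<open>m\<close>
  both give the exact integral. Among all pairs of weights with sum 1, this is the one for which the
  weighted mean of \<open>\<mu>\<^sub>A\<close> and \<open>\<mu>\<^sub>B\<close> equals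
  \<open>\<mu>\<close>; it exists because \<open>\<mu>\<^sub>A \<noteq> \<mu>\<^sub>B\<close>, and
  it makes \<open>Y\<close> exact at \<open>\<phi> (m + 1)\<close> as well.\<close>

theorem proposition1:
  fixes m :: nat
    and A B Y :: "(real \<Rightarrow> real) \<Rightarrow> real"
    and \<mu> \<mu>\<^sub>A \<mu>\<^sub>B :: real
  assumes "quadrature_rule A" and "quadrature_rule B"
    and "of_degree A m" and "of_degree B m"
    and "\<mu>\<^sub>A = A (\<phi> (m + 1))" and "\<mu>\<^sub>B = B (\<phi> (m + 1))" and "\<mu>\<^sub>A \<noteq> \<mu>\<^sub>B"
    and "\<mu> = integral {-1..1} (\<lambda>t. t ^ (m + 1))"
    and "\<And>g. Y g = (\<mu> - \<mu>\<^sub>B) / (\<mu>\<^sub>A - \<mu>\<^sub>B) * A g + (\<mu>\<^sub>A - \<mu>) / (\<mu>\<^sub>A - \<mu>\<^sub>B) * B g"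
  shows "\<forall>j\<le>m + 1. Y (\<phi> j) = integral {-1..1} (\<lambda>t. t ^ j)"
proof (intro allI impI)
  fix j assume "j \<le> m + 1"
  have d: "\<mu>\<^sub>A - \<mu>\<^sub>B \<noteq> 0" using assms(7) by simp
  show "Y (\<phi> j) = integral {-1..1} (\<lambda>t. t ^ j)"
  proof (cases "j = m + 1")
    case True
    have "Y (\<phi> j) = ((\<mu> - \<mu>\<^sub>B) * \<mu>\<^sub>A + (\<mu>\<^sub>A - \<mu>) * \<mu>\<^sub>B) / (\<mu>\<^sub>A - \<mu>\<^sub>B)"
      unfolding assms(9) True assms(5,6) by (simp add: add_divide_distrib)
    \<comment> \<open>The products \<open>\<mu>\<^sub>A * \<mu>\<^sub>B\<close> cancel, and what
      remains is \<open>\<mu>\<close> times the common denominator of the weights.\<close>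
    also have "(\<mu> - \<mu>\<^sub>B) * \<mu>\<^sub>A + (\<mu>\<^sub>A - \<mu>) * \<mu>\<^sub>B = \<mu> * (\<mu>\<^sub>A - \<mu>\<^sub>B)"
      by (simp add: algebra_simps)
    finally show ?thesis using d assms(8) True by simp
  next
    case False
    with \<open>j \<le> m + 1\<close> have "j \<le> m" by simp
    with assms(3,4) have AB: "A (\<phi> j) = I (\<phi> j)" "B (\<phi> j) = I (\<phi> j)"
      by (auto simp: of_degree_def)
    have "Y (\<phi> j) = ((\<mu> - \<mu>\<^sub>B) / (\<mu>\<^sub>A - \<mu>\<^sub>B) + (\<mu>\<^sub>A - \<mu>) / (\<mu>\<^sub>A - \<mu>\<^sub>B)) * I (\<phi> j)"
      unfolding assms(9) AB by (rule distrib_right[symmetric])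
    \<comment> \<open>In the sum of the numerators \<open>\<mu>\<close> cancels, which leaves
      exactly the nonzero denominator: the weights sum to 1 whatever the value of
      \<open>\<mu>\<close>.\<close>
    also have "(\<mu> - \<mu>\<^sub>B) / (\<mu>\<^sub>A - \<mu>\<^sub>B) + (\<mu>\<^sub>A - \<mu>) / (\<mu>\<^sub>A - \<mu>\<^sub>B) = 1"
      using d by (simp flip: add_divide_distrib)
    finally show ?thesis by (simp add: I_def \<phi>_def)
  qed
qed

end
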